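(* There exists an absolute constant $c > 0$ such that for every finite set $A \subset \mathbb{C}$ with $|A| \geq 2$, $$|A + A \cdot A| \geq c \cdot \frac{|A|^{1.5}}{\sqrt{\log |A|}}.$$
   Context: For $A \subset \mathbb{C}$, $A + A \cdot A = \{a + bc : a, b, c \in A\}$. *)

theory Defs
  imports Complex_Main
begin

definition sum_prod_set :: "complex set \<Rightarrow> complex set" where
  "sum_prod_set A = {a + b * c | a b c. a \<in> A \<and> b \<in> A \<and> c \<in> A}"

end

(* The lines y = a + b x with a, b in A and b nonzero send A into B = A + A A.  Join every x in A to a
   nearest neighbour x' at distance r x.  The discs of radius r x around the points x overlap boundedly,
   and similarities of the plane preserve this, so on each line at least half of the discs around
   a + b x of radius |b| (r x) contain at most m = O(|B| / |A|) points of B.  For fixed x the line is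
   determined by the pair (a + b x, a + b x'), and in such a case the second point is among the m points of B
   closest to the first; this leaves at most m |B| lines.  Comparing the two counts of pairs (line, x) gives
   |A|^3 = O(|B|^2), without a logarithmic loss. *)
theory Submission
  imports Defs "HOL-Analysis.Inner_Product"
begin

text \<open>In the triangle with vertices 0, \<open>a\<close>, \<open>b\<close> the side from
  \<open>a\<close> to \<open>b\<close> is a longest one, so the angle at 0 is at least 60 degrees
  and the unit vectors along the other two sides are at least 1 apart. If one vector is 0, its
  \<open>sgn\<close> is 0, at distance 1 from any unit vector.\<close>

lemma dist_sgn_ge_1:
  fixes a b :: "'a::real_inner"
  assumes "a \<noteq> b" "norm a \<le> norm (a - b)" "norm b \<le> norm (a - b)"
  shows "dist (sgn a) (sgn b) \<ge> 1"
proof (cases "a = 0 \<or> b = 0")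
  case True
  then show ?thesis using assms(1) by (auto simp: dist_norm norm_sgn)
next
  case False
  then have a: "norm a > 0" and b: "norm b > 0" by auto
  \<comment> \<open>Law of cosines: subtracting the largest of the three squares leaves at most the
    smaller of the other two, hence at most the product of the norms. So the cosine is at most
    1/2.\<close>
  have "2 * inner a b = (norm a)\<^sup>2 + (norm b)\<^sup>2 - (norm (a - b))\<^sup>2"
    by (simp add: dot_norm_neg)
  moreover have "(norm a)\<^sup>2 \<le> (norm (a - b))\<^sup>2" "(norm b)\<^sup>2 \<le> (norm (a - b))\<^sup>2"
    using assms by (auto intro: power_mono)
  moreover have "min ((norm a)\<^sup>2) ((norm b)\<^sup>2) \<le> norm a * norm b"
    unfolding min_le_iff_disj power2_eq_square using a b
    by (meson linear mult_left_mono mult_right_mono norm_ge_zero)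
  ultimately have ab: "2 * inner a b \<le> norm a * norm b"
    by linarith
  have "inner (sgn a) (sgn b) = inner a b / (norm a * norm b)"
    by (simp add: sgn_div_norm divide_inverse)
  also have "\<dots> \<le> 1 / 2"
    using ab a b by (simp add: divide_le_eq)
  finally have "inner (sgn a) (sgn b) \<le> 1 / 2" .
  moreover have "2 * inner (sgn a) (sgn b) = 1 + 1 - (norm (sgn a - sgn b))\<^sup>2"
    using False by (simp add: dot_norm_neg norm_sgn)
  ultimately have "1 \<le> (norm (sgn a - sgn b))\<^sup>2" by linarith
  then have "1\<^sup>2 \<le> (norm (sgn a - sgn b))\<^sup>2" by simp
  then show ?thesis
    unfolding dist_norm by (rule power2_le_imp_le) simp
qed

lemma floor_double_diff:
  fixes s t :: real
  assumes "\<lfloor>2 * s\<rfloor> = \<lfloor>2 * t\<rfloor>"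
  shows "(s - t)\<^sup>2 < 1 / 4"
proof -
  have "\<bar>s - t\<bar> < 1 / 2" using assms by linarith
  then have "\<bar>s - t\<bar>\<^sup>2 < (1 / 2)\<^sup>2" by (rule power_strict_mono) auto
  then show ?thesis by (simp add: power2_eq_square)
qed

text \<open>The directions from \<open>z\<close> to the centres are 1-separated, hence fall into distinct cells of a
  square grid of mesh \<open>1 / 2\<close>.\<close>

lemma card_discs_containing_point:
  fixes S :: "complex set" and r :: "complex \<Rightarrow> real"
  assumes r: "\<And>x y. x \<in> S \<Longrightarrow> y \<in> S \<Longrightarrow> x \<noteq> y \<Longrightarrow> r x \<le> dist x y"
  shows "card {x \<in> S. dist x z \<le> r x} \<le> 25"
proof -
  define cell where "cell x = (\<lfloor>2 * Re (sgn (x - z))\<rfloor>, \<lfloor>2 * Im (sgn (x - z))\<rfloor>)" for x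
  let ?D = "{x \<in> S. dist x z \<le> r x}"
  have "inj_on cell ?D"
  proof (rule inj_onI, rule ccontr)
    fix x y assume x: "x \<in> ?D" and y: "y \<in> ?D" and eq: "cell x = cell y" and ne: "x \<noteq> y"
    have "norm (x - z) \<le> norm ((x - z) - (y - z))" "norm (y - z) \<le> norm ((x - z) - (y - z))"
      using x y ne r[of x y] r[of y x] by (auto simp: dist_norm norm_minus_commute)
    then have "1 \<le> dist (sgn (x - z)) (sgn (y - z))"
      using ne by (intro dist_sgn_ge_1) auto
    then have "1 \<le> (cmod (sgn (x - z) - sgn (y - z)))\<^sup>2"
      by (simp add: dist_norm)
    moreover have "(Re (sgn (x - z)) - Re (sgn (y - z)))\<^sup>2 < 1 / 4"
        "(Im (sgn (x - z)) - Im (sgn (y - z)))\<^sup>2 < 1 / 4"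
      using eq unfolding cell_def prod.inject by (blast intro: floor_double_diff)+
    ultimately show False by (simp add: cmod_power2)
  qed
  \<comment> \<open>Both coordinates of a \<open>sgn\<close> lie in [-1, 1], so doubling and
    rounding down leaves 5 values each and 5 * 5 = 25 cells. A centre equal to \<open>z\<close> has
    direction 0 and is covered too.\<close>
  moreover have "cell ` ?D \<subseteq> {-2..2} \<times> {-2..2}"
  proof -
    have "\<lfloor>2 * t\<rfloor> \<in> {-2..2}" if "\<bar>t\<bar> \<le> 1" for t :: real
      using that by (auto simp: abs_le_iff le_floor_iff floor_le_iff)
    moreover have "cmod (sgn w) \<le> 1" for w
      by (simp add: norm_sgn)
    ultimately show ?thesis
      unfolding cell_def using abs_Re_le_cmod abs_Im_le_cmod by (blast intro: order_trans)
  qed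
  ultimately have "card ?D \<le> card ({-2..2::int} \<times> {-2..2::int})"
    by (rule card_inj_on_le) simp
  then show ?thesis by simp
qed

text \<open>Take the member \<open>u\<close> of the set farthest from \<open>y\<close>: the closed
  ball about \<open>y\<close> through \<open>u\<close> contains the whole set, and by membership of
  \<open>u\<close> it has at most \<open>m\<close> points of \<open>B\<close>. Counting closed balls
  avoids breaking ties between equidistant points.\<close>

lemma card_low_rank_le:
  fixes B :: "'a::metric_space set" and m :: real
  assumes "finite B" "m \<ge> 0"
  shows "real (card {y' \<in> B. real (card {w \<in> B. dist y w \<le> dist y y'}) \<le> m}) \<le> m"
    (is "real (card ?L) \<le> m")
proof (cases "?L = {}")
  case True
  then show ?thesis using assms(2) by (simp only: card.empty)
next
  case False
  have "finite ?L" using assms by simp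
  then obtain u where u: "u \<in> ?L" "\<forall>v\<in>?L. dist y v \<le> dist y u"
    using False ex_is_arg_min_if_finite[of ?L "\<lambda>v. - dist y v"]
    unfolding is_arg_min_linorder by auto
  then have "card ?L \<le> card {w \<in> B. dist y w \<le> dist y u}"
    using assms by (intro card_mono) auto
  then show ?thesis using u by simp
qed

lemma card_sum_prod_set_ge:
  fixes A :: "complex set"
  assumes fin: "finite A" and two: "card A \<ge> 2"
  shows "real (card A) ^ 3 \<le> 200 * real (card (sum_prod_set A)) ^ 2"
proof -
  define B where "B = sum_prod_set A"
  \<comment> \<open>A pair \<open>(a, b)\<close> encodes the line y = a + b x; with \<open>b\<close>
    nonzero this map is a similarity of ratio \<open>norm b\<close>.\<close>
  define L where "L = A \<times> (A - {0})"
  define near where "near x = (SOME y. is_arg_min (dist x) (\<lambda>y. y \<in> A - {x}) y)" for x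
  define r where "r x = dist x (near x)" for x
  define disc where "disc l x = {w \<in> B. dist (fst l + snd l * x) w \<le> norm (snd l) * r x}" for l x
  \<comment> \<open>Chosen so that 25 |B| / m = |A| / 2, where 25 is the bound on the overlap of the
    discs.\<close>
  define m where "m = 50 * real (card B) / real (card A)"
  have "B = (\<lambda>(a, b, c). a + b * c) ` (A \<times> A \<times> A)"
    unfolding B_def sum_prod_set_def by force
  with fin have finB: "finite B" by simp
  have A_ne: "A \<noteq> {}" and n: "real (card A) > 0" using two by auto
  have inB: "a + b * c \<in> B" if "a \<in> A" "b \<in> A" "c \<in> A" for a b c
    using that unfolding B_def sum_prod_set_def by auto
  have B_pos: "real (card B) > 0"
    using inB A_ne finB by (auto simp: card_gt_0_iff)
  have m: "m > 0" unfolding m_def using n B_pos by simp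
  have finL: "finite L" unfolding L_def using fin by simp
  have near: "near x \<in> A" "near x \<noteq> x" "\<And>y. y \<in> A \<Longrightarrow> y \<noteq> x \<Longrightarrow> r x \<le> dist x y" if "x \<in> A" for x
  proof -
    have "A - {x} \<noteq> {}"
      using two that fin by (metis card_Diff_singleton card.empty Suc_1 diff_is_0_eq not_less_eq_eq)
    then have "is_arg_min (dist x) (\<lambda>y. y \<in> A - {x}) (near x)"
      unfolding near_def using fin by (intro someI_ex[OF ex_is_arg_min_if_finite]) auto
    then show "near x \<in> A" "near x \<noteq> x" "\<And>y. y \<in> A \<Longrightarrow> y \<noteq> x \<Longrightarrow> r x \<le> dist x y"
      unfolding is_arg_min_linorder r_def by auto
  qed

  have half: "real (card A) / 2 \<le> real (card {x \<in> A. real (card (disc l x)) \<le> m})"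
    if l: "l \<in> L" for l
  proof -
    obtain a b where ab: "l = (a, b)" "b \<noteq> 0" using l unfolding L_def by auto
    have cover: "card {x \<in> A. w \<in> disc l x} \<le> 25" for w
    proof -
      \<comment> \<open>Pulling \<open>w\<close> back along the similarity reduces the overlap of
        the image discs to that of the nearest-neighbour discs in \<open>A\<close>.\<close>
      have "dist (a + b * x) w = norm b * dist x ((w - a) / b)" for x
      proof -
        have "a + b * x - w = b * (x - (w - a) / b)" using ab by (simp add: field_simps)
        then show ?thesis by (simp add: dist_norm norm_mult)
      qed
      then have "{x \<in> A. w \<in> disc l x} \<subseteq> {x \<in> A. dist x ((w - a) / b) \<le> r x}"
        unfolding disc_def using ab by auto
      then have "card {x \<in> A. w \<in> disc l x} \<le> card {x \<in> A. dist x ((w - a) / b) \<le> r x}"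
        using fin by (intro card_mono) auto
      also have "\<dots> \<le> 25"
        by (rule card_discs_containing_point) (use near in blast)
      finally show ?thesis .
    qed
    let ?bad = "{x \<in> A. \<not> real (card (disc l x)) \<le> m}"
    \<comment> \<open>Markov's inequality: every bad disc has more than \<open>m\<close> points,
      while by \<open>cover\<close> each point of \<open>B\<close> lies in at most 25 discs.\<close>
    have "real (card ?bad) * m \<le> (\<Sum>x\<in>?bad. real (card (disc l x)))"
      by (rule sum_bounded_below) auto
    also have "\<dots> \<le> (\<Sum>x\<in>A. real (card (disc l x)))"
      using fin by (intro sum_mono2) auto
    also have "\<dots> = (\<Sum>x\<in>A. \<Sum>w\<in>B. of_bool (w \<in> disc l x))"
      using finB by (intro sum.cong refl) (simp add: disc_def Int_def)
    also have "\<dots> = (\<Sum>w\<in>B. \<Sum>x\<in>A. of_bool (w \<in> disc l x))"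
      by (rule sum.swap)
    also have "\<dots> = (\<Sum>w\<in>B. real (card {x \<in> A. w \<in> disc l x}))"
      using fin by (intro sum.cong refl) (simp add: Int_def)
    also have "\<dots> \<le> (\<Sum>w\<in>B. 25)"
      using cover by (intro sum_mono) (metis of_nat_le_iff of_nat_numeral)
    finally have "real (card ?bad) \<le> 25 * real (card B) / m"
      using m by (simp add: field_simps)
    also have "\<dots> = real (card A) / 2"
      unfolding m_def using n B_pos by (simp add: field_simps)
    finally have "real (card ?bad) \<le> real (card A) / 2" .
    moreover have "card A = card {x \<in> A. real (card (disc l x)) \<le> m} + card ?bad"
      using fin by (subst card_Un_disjoint[symmetric]) (auto intro: arg_cong[where f = card])
    ultimately show ?thesis by simp
  qed

  have few: "real (card {l \<in> L. real (card (disc l x)) \<le> m}) \<le> real (card B) * m"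
    if x: "x \<in> A" for x
  proof -
    define rich where "rich y = {y' \<in> B. real (card {w \<in> B. dist y w \<le> dist y y'}) \<le> m}" for y
    define f where "f l = (fst l + snd l * x, fst l + snd l * near x)" for l
    have "inj_on f {l \<in> L. real (card (disc l x)) \<le> m}"
    proof (rule inj_onI)
      fix k l :: "complex \<times> complex" assume "f k = f l"
      then have e: "fst k + snd k * x = fst l + snd l * x"
        "fst k + snd k * near x = fst l + snd l * near x"
        by (auto simp: f_def)
      \<comment> \<open>A line is determined by its values at two distinct arguments: the difference
        of the two equations gives the slope.\<close>
      then have "(snd k - snd l) * (near x - x) = 0"
        by algebra
      then have "snd k = snd l" using near(2)[OF x] by simp
      with e show "k = l" by (simp add: prod_eq_iff)
    qed
    moreover have "f ` {l \<in> L. real (card (disc l x)) \<le> m} \<subseteq> Sigma B rich"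
    proof (clarsimp simp: f_def)
      fix a b assume ab: "(a, b) \<in> L" and le: "real (card (disc (a, b) x)) \<le> m"
      \<comment> \<open>The image of the nearest neighbour lies on the boundary of the disc, so the
        ball counted in \<open>rich\<close> is the disc itself.\<close>
      have "dist (a + b * x) (a + b * near x) = norm b * r x"
        by (simp add: dist_norm r_def norm_mult flip: right_diff_distrib)
      then show "a + b * x \<in> B \<and> a + b * near x \<in> rich (a + b * x)"
        using ab le inB near[OF x] x unfolding L_def rich_def disc_def by auto
    qed
    moreover have "finite (Sigma B rich)" using finB by (auto simp: rich_def)
    ultimately have "card {l \<in> L. real (card (disc l x)) \<le> m} \<le> card (Sigma B rich)"
      by (rule card_inj_on_le)
    also have "card (Sigma B rich) = (\<Sum>y\<in>B. card (rich y))"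
      using finB by (simp add: rich_def)
    finally have "real (card {l \<in> L. real (card (disc l x)) \<le> m}) \<le> (\<Sum>y\<in>B. real (card (rich y)))"
      by (simp only: of_nat_le_iff flip: of_nat_sum)
    also have "\<dots> \<le> (\<Sum>y\<in>B. m)"
      unfolding rich_def using m finB by (intro sum_mono card_low_rank_le) auto
    finally show ?thesis by simp
  qed

  \<comment> \<open>Double count the pairs of a line \<open>l\<close> and a point \<open>x\<close>
    with at most \<open>m\<close> points in the disc: \<open>half\<close> bounds them below line by
    line, \<open>few\<close> above point by point.\<close>
  have "real (card L) * (real (card A) / 2) \<le> (\<Sum>l\<in>L. real (card {x \<in> A. real (card (disc l x)) \<le> m}))"
    using half by (intro sum_bounded_below) auto
  also have "\<dots> = (\<Sum>l\<in>L. \<Sum>x\<in>A. of_bool (real (card (disc l x)) \<le> m))"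
    using fin by (simp add: Int_def)
  also have "\<dots> = (\<Sum>x\<in>A. \<Sum>l\<in>L. of_bool (real (card (disc l x)) \<le> m))"
    by (rule sum.swap)
  also have "\<dots> = (\<Sum>x\<in>A. real (card {l \<in> L. real (card (disc l x)) \<le> m}))"
    using finL by (simp add: Int_def)
  also have "\<dots> \<le> real (card A) * (real (card B) * m)"
    using few by (intro sum_bounded_above) auto
  also have "\<dots> = 50 * real (card B) ^ 2"
    unfolding m_def using n by (simp add: power2_eq_square)
  finally have "real (card L) * real (card A) \<le> 100 * real (card B) ^ 2" by simp
  moreover have "real (card A) * (real (card A) / 2) \<le> real (card L)"
  proof -
    \<comment> \<open>Removing 0 loses at most one slope, and |A| - 1 is at least |A| / 2 because
      |A| is at least 2.\<close>
    have "card A - 1 \<le> card (A - {0})"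
      using fin by (simp add: card_Diff_singleton_if)
    then have "real (card A) / 2 \<le> real (card (A - {0}))" using two by linarith
    then show ?thesis
      unfolding L_def card_cartesian_product of_nat_mult by (rule mult_left_mono) simp
  qed
  then have "real (card A) * (real (card A) / 2) * real (card A) \<le> real (card L) * real (card A)"
    by (rule mult_right_mono) simp
  ultimately have "real (card A) ^ 3 \<le> 200 * real (card B) ^ 2"
    by (simp add: power3_eq_cube)
  then show ?thesis unfolding B_def .
qed

theorem corollary1p7:
  shows "\<exists>C::real. C > 0 \<and>
    (\<forall>A :: complex set. finite A \<and> card A \<ge> 2 \<longrightarrow>
      real (card (sum_prod_set A)) \<ge>
        C * (real (card A) powr (3 / 2) / sqrt (ln (real (card A)))))"
proof (intro exI[of _ "1 / 30"] conjI allI impI)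
  \<comment> \<open>The constant 1/30 is 1/15 times 1/2: 200 is at most 15 squared, and
    \<open>sqrt (ln n)\<close> is at least 1/2, so dividing by it at most doubles.\<close>
  fix A :: "complex set"
  assume A: "finite A \<and> card A \<ge> 2"
  define n where "n = real (card A)"
  define N where "N = real (card (sum_prod_set A))"
  have n: "n \<ge> 2" using A by (simp add: n_def)
  have "ln (1 / n) \<le> 1 / n - 1" using n by (intro ln_le_minus_one) simp
  moreover have "1 / n \<le> 1 / 2" using n by simp
  moreover have "ln (1 / n) = - ln n" using n by (simp add: ln_div)
  ultimately have "1 / 4 \<le> ln n" by linarith
  then have s: "1 / 2 \<le> sqrt (ln n)" by (intro real_le_rsqrt) (simp add: power2_eq_square)
  have "(n powr (3 / 2))\<^sup>2 = n ^ 3"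
    using n by (simp add: powr_powr flip: powr_realpow powr_numeral)
  also have "\<dots> \<le> 200 * N\<^sup>2"
    unfolding n_def N_def using A by (intro card_sum_prod_set_ge) auto
  also have "\<dots> \<le> (15 * N)\<^sup>2" by (simp add: power_mult_distrib)
  finally have "n powr (3 / 2) \<le> 15 * N" by (rule power2_le_imp_le) (simp add: N_def)
  moreover have "n powr (3 / 2) / sqrt (ln n) \<le> n powr (3 / 2) / (1 / 2)"
    using s n by (intro divide_left_mono) auto
  ultimately show "real (card (sum_prod_set A)) \<ge>
      1 / 30 * (real (card A) powr (3 / 2) / sqrt (ln (real (card A))))"
    unfolding n_def[symmetric] N_def[symmetric] by simp
qed simp

end
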